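(* Let $R$ be a UFD of characteristic $p>0$, $R[x,y]$ the polynomial ring, $0\ne a\in R$, $0\ne\theta(y)\in yR[y]$, $f:=ax+\theta(y)$, $0\ne F\in R[f]$, and let $\phi\in\operatorname{Aut}_RR[x,y]$ be given by $\phi(y)=y+aF$, $\phi(x)=x+a^{-1}(\theta(y)-\theta(y+aF))$. Let $I:=aR[x,y]+\theta'(y)R[x,y]$ and $d:=\gcd(a,\theta'(y))\in R$. The following are equivalent: (a) $I$ is a principal ideal of $R[x,y]$; (b) $I=dR[x,y]$; (c) $\operatorname{pl}(\phi)=dF\,R[x,y]^{\phi}$; (d) $\operatorname{pl}(\phi)$ is a principal ideal of $R[x,y]^{\phi}$.
   Context: $\theta'(y)$ is the formal derivative; $d$ is a greatest common divisor in $R[y]$ of $a$ and $\theta'(y)$, taken in $R$. For an automorphism $\phi$ of a ring $B$, $B^{\phi}:=\{u\mid\phi(u)=u\}$ and the plinth ideal is $\operatorname{pl}(\phi):=\{\phi(u)-u\mid u\in B\}\cap B^{\phi}$. *)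

theory Defs
  imports "HOL-Computational_Algebra.Computational_Algebra"
begin

text \<open>The bivariate polynomial ring R[x,y] is modelled as 'a poly poly:
  an element is a polynomial in the (outer) variable x whose coefficients
  are polynomials in the (inner) variable y.\<close>

definition cst2 :: "'a::comm_semiring_1 \<Rightarrow> 'a poly poly" where
  "cst2 r = [:[:r:]:]"

definition X2 :: "'a::comm_semiring_1 poly poly" where
  "X2 = [:0, 1:]"

definition Y2 :: "'a::comm_semiring_1 poly poly" where
  "Y2 = [:[:0, 1:]:]"

definition eval2 :: "'a::comm_semiring_1 poly \<Rightarrow> 'a poly poly \<Rightarrow> 'a poly poly" where
  "eval2 g u = poly (map_poly cst2 g) u"

definition subst2 :: "'a::comm_semiring_1 poly poly \<Rightarrow> 'a poly poly \<Rightarrow> 'a poly poly \<Rightarrow> 'a poly poly" where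
  "subst2 u v P = poly (map_poly (\<lambda>c. eval2 c v) P) u"

definition fixed_ring :: "('b \<Rightarrow> 'b) \<Rightarrow> 'b set" where
  "fixed_ring phi = {u. phi u = u}"

definition plinth :: "('b::ab_group_add \<Rightarrow> 'b) \<Rightarrow> 'b set" where
  "plinth phi = {phi u - u | u. True} \<inter> fixed_ring phi"

definition principal_in :: "'b::times set \<Rightarrow> 'b \<Rightarrow> 'b set" where
  "principal_in S g = {g * w | w. w \<in> S}"

end

theory Submission
  imports Defs
begin

text \<open>Write \<open>B = R[x,y]\<close>, \<open>a = d a'\<close> and \<open>D = d F\<close>. Taylor expansion gives \<open>\<phi> u - u \<in> F I\<close> for all
  \<open>u \<in> B\<close>, whence \<open>pl(\<phi>) \<subseteq> D B\<^sup>\<phi>\<close> and (c) implies (b). Conversely \<open>D c\<close> lies in the plinth ideal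
  whenever \<open>c\<close> and \<open>h\<close> are invariants with \<open>c y \<equiv> h\<close> modulo \<open>a'\<close>, because then
  \<open>s = (c y - h) / a'\<close> satisfies \<open>\<phi> s - s = D c\<close>.

  Among the residues modulo \<open>a'\<close> of invariants are \<open>y\<^sup>p\<close>, from \<open>y\<^sup>p - (aF)\<^bsup>p-1\<^esup> y\<close>, and
  \<open>\<eta> = (\<theta> - \<theta>\<^sub>0) / d\<close>, where \<open>\<theta>\<^sub>0\<close> collects the monomials of \<open>\<theta>\<close> whose exponent is a multiple
  of \<open>p\<close>; note \<open>\<theta>' = d \<eta>'\<close>. Over any domain some \<open>C = \<eta>'\<^bsup>pm\<^esup>\<close> satisfies \<open>C, C y \<in> R[y\<^sup>p, \<eta>]\<close>.
  If \<open>I = d B\<close>, then \<open>\<eta>'\<close>, hence \<open>C\<close>, is invertible modulo \<open>a'\<close>, so \<open>y\<close> itself is the residue of an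
  invariant and \<open>D \<in> pl(\<phi>)\<close>. If \<open>pl(\<phi>)\<close> is generated by \<open>D w\<close>, then \<open>w\<close> divides both \<open>a'\<close> and
  \<open>C\<close>; as \<open>a'\<close> and \<open>\<eta>'\<close> have no common prime divisor, \<open>w\<close> is a unit.\<close>

section \<open>Evaluation and substitution\<close>

lemma cst2_simps [simp]:
  "cst2 0 = 0" "cst2 1 = 1"
  "cst2 (r + s) = cst2 r + cst2 s" "cst2 (r * s) = cst2 r * cst2 s"
  by (simp_all add: cst2_def one_pCons)

lemma eval2_0 [simp]: "eval2 0 u = 0"
  by (simp add: eval2_def)

lemma eval2_pCons [simp]: "eval2 (pCons c g) u = cst2 c + u * eval2 g u"
  by (simp add: eval2_def map_poly_pCons)

lemma eval2_1 [simp]: "eval2 1 u = 1"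
  by (simp add: one_pCons)

lemma eval2_add [simp]:
  fixes g h :: "'a::idom poly"
  shows "eval2 (g + h) u = eval2 g u + eval2 h u"
  by (induction g h rule: poly_induct2) (simp_all add: algebra_simps)

lemma eval2_smult [simp]:
  fixes g :: "'a::idom poly"
  shows "eval2 (smult c g) u = cst2 c * eval2 g u"
  by (induction g) (simp_all add: algebra_simps)

lemma eval2_mult [simp]:
  fixes g h :: "'a::idom poly"
  shows "eval2 (g * h) u = eval2 g u * eval2 h u"
  by (induction g) (simp_all add: algebra_simps)

lemma eval2_power [simp]:
  fixes g :: "'a::idom poly"
  shows "eval2 (g ^ n) u = eval2 g u ^ n"
  by (induction n) simp_all

lemma eval2_diff [simp]:
  fixes g h :: "'a::idom poly"
  shows "eval2 (g - h) u = eval2 g u - eval2 h u"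
  using eval2_add[of "g - h" h u] by (simp add: algebra_simps)

lemma eval2_Y2: "eval2 g Y2 = [:g:]"
  by (induction g) (simp_all add: cst2_def Y2_def)

lemma eval2_taylor:
  fixes g :: "'a::idom poly"
  shows "\<exists>h. eval2 g (u + t) = eval2 g u + eval2 (pderiv g) u * t + t^2 * h"
proof (induction g)
  case (pCons c g)
  then obtain h where h: "eval2 g (u + t) = eval2 g u + eval2 (pderiv g) u * t + t^2 * h"
    by blast
  have "eval2 (pCons c g) (u + t)
      = cst2 c + (u + t) * (eval2 g u + eval2 (pderiv g) u * t + t^2 * h)"
    by (simp only: eval2_pCons h)
  also have "\<dots> = eval2 (pCons c g) u + eval2 (pderiv (pCons c g)) u * t
      + t^2 * (eval2 (pderiv g) u + u * h + t * h)"
    by (simp add: pderiv_pCons algebra_simps power2_eq_square)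
  finally show ?case by blast
qed auto

lemma subst2_0 [simp]: "subst2 u v 0 = 0"
  by (simp add: subst2_def)

lemma subst2_pCons [simp]: "subst2 u v (pCons c P) = eval2 c v + u * subst2 u v P"
  by (simp add: subst2_def map_poly_pCons)

lemma subst2_1 [simp]: "subst2 u v 1 = 1"
  by (simp add: one_pCons)

lemma subst2_add [simp]:
  fixes P Q :: "'a::idom poly poly"
  shows "subst2 u v (P + Q) = subst2 u v P + subst2 u v Q"
  by (induction P Q rule: poly_induct2) (simp_all add: algebra_simps)

lemma subst2_smult [simp]:
  fixes P :: "'a::idom poly poly"
  shows "subst2 u v (smult c P) = eval2 c v * subst2 u v P"
  by (induction P) (simp_all add: algebra_simps)

lemma subst2_mult [simp]:
  fixes P Q :: "'a::idom poly poly"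
  shows "subst2 u v (P * Q) = subst2 u v P * subst2 u v Q"
  by (induction P) (simp_all add: algebra_simps)

lemma subst2_diff [simp]:
  fixes P Q :: "'a::idom poly poly"
  shows "subst2 u v (P - Q) = subst2 u v P - subst2 u v Q"
  using subst2_add[of u v "P - Q" Q] by (simp add: algebra_simps)

lemma subst2_power [simp]:
  fixes P :: "'a::idom poly poly"
  shows "subst2 u v (P ^ n) = subst2 u v P ^ n"
  by (induction n) simp_all

lemma subst2_cst2 [simp]: "subst2 u v (cst2 r) = cst2 r"
  by (simp add: cst2_def)

lemma subst2_X2 [simp]: "subst2 u v X2 = u"
  by (simp add: X2_def)

lemma subst2_Y2 [simp]: "subst2 u v Y2 = v"
  by (simp add: Y2_def)

lemma subst2_eval2:
  fixes g :: "'a::idom poly"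
  shows "subst2 u v (eval2 g w) = eval2 g (subst2 u v w)"
  by (induction g) simp_all

lemma eval2_shift_dvd:
  fixes g :: "'a::idom poly"
  shows "t dvd eval2 g (u + t) - eval2 g u"
proof -
  obtain h where "eval2 g (u + t) = eval2 g u + eval2 (pderiv g) u * t + t^2 * h"
    using eval2_taylor by blast
  hence "eval2 g (u + t) - eval2 g u = t * (eval2 (pderiv g) u + t * h)"
    by (simp add: algebra_simps power2_eq_square)
  thus ?thesis by simp
qed

text \<open>Reduces the increment \<open>\<phi> u - u\<close> of an arbitrary \<open>u\<close> to
  the increments of the two generators x and y.\<close>

lemma subst2_shift:
  fixes P :: "'a::idom poly poly"
  shows "\<exists>r s. subst2 (X2 + q) (Y2 + t) P - P = q * r + t * s"
proof (induction P)
  case (pCons c P)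
  then obtain r s where rs: "subst2 (X2 + q) (Y2 + t) P - P = q * r + t * s" by blast
  obtain k where k: "eval2 c (Y2 + t) - eval2 c Y2 = t * k"
    using eval2_shift_dvd by (metis dvdE)
  have P: "pCons c P = [:c:] + X2 * P" by (simp add: X2_def)
  have "subst2 (X2 + q) (Y2 + t) (pCons c P) - pCons c P
      = (eval2 c (Y2 + t) - eval2 c Y2) + X2 * (subst2 (X2 + q) (Y2 + t) P - P)
        + q * subst2 (X2 + q) (Y2 + t) P"
    by (simp add: P eval2_Y2[symmetric] subst2_eval2 algebra_simps)
  also have "\<dots> = q * (X2 * r + subst2 (X2 + q) (Y2 + t) P) + t * (k + X2 * s)"
    unfolding rs k by (simp add: algebra_simps)
  finally show ?case by blast
next
  case 0
  show ?case by (rule exI[of _ 0])+ simp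
qed

section \<open>Projection onto polynomials in the \<open>p\<close>-th power of the variable\<close>

definition pth_part :: "nat \<Rightarrow> 'a::idom poly \<Rightarrow> 'a poly" where
  "pth_part p w = (\<Sum>i\<le>degree w. if p dvd i then monom (coeff w i) i else 0)"

lemma coeff_pth_part [simp]:
  "coeff (pth_part p w) n = (if p dvd n then coeff w n else 0)"
proof -
  have "coeff (pth_part p w) n = (\<Sum>i\<le>degree w. if i = n then if p dvd n then coeff w n else 0 else 0)"
    unfolding pth_part_def coeff_sum by (intro sum.cong) auto
  also have "\<dots> = (if p dvd n then coeff w n else 0)"
    by (auto simp: coeff_eq_0)
  finally show ?thesis .
qed

lemma pth_part_0 [simp]: "pth_part p 0 = 0"
  by (rule poly_eqI) simp

lemma pth_part_add: "pth_part p (v + w) = pth_part p v + pth_part p w"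
  by (rule poly_eqI) simp

lemma pth_part_smult: "pth_part p (smult c w) = smult c (pth_part p w)"
  by (rule poly_eqI) simp

text \<open>Shifting exponents by \<open>p\<close> preserves divisibility by \<open>p\<close>. With
  the two preceding rules this gives linearity over \<open>R[y^p]\<close>.\<close>

lemma pth_part_monom_mult: "pth_part p (monom 1 p * w) = monom 1 p * pth_part p w"
  by (rule poly_eqI) (auto simp: coeff_monom_mult dvd_minus_self)

lemma pderiv_eq_0_imp_pth_part:
  fixes w :: "'a::idom poly"
  assumes "pderiv w = 0"
  shows "pth_part CHAR('a) w = w"
proof (rule poly_eqI)
  fix n
  have "coeff w n = 0" if "\<not> CHAR('a) dvd n"
  proof -
    from that obtain m where n: "n = Suc m" by (cases n) auto
    have "of_nat n * coeff w n = 0"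
      using assms coeff_pderiv[of w m] by (simp add: n)
    thus ?thesis using that by (auto simp: of_nat_eq_0_iff_char_dvd)
  qed
  thus "coeff (pth_part CHAR('a) w) n = coeff w n" by simp
qed

lemma pderiv_pth_part:
  fixes w :: "'a::idom poly"
  shows "pderiv (pth_part CHAR('a) w) = 0"
  by (rule poly_eqI) (auto simp: coeff_pderiv of_nat_eq_0_iff_char_dvd simp del: of_nat_Suc)

lemma pth_part_power:
  fixes w :: "'a::idom poly"
  shows "pth_part CHAR('a) (w ^ (CHAR('a) * m)) = w ^ (CHAR('a) * m)"
proof (rule pderiv_eq_0_imp_pth_part)
  have "pderiv (w ^ n) = smult (of_nat n) (w ^ (n - 1) * pderiv w)" for n
    by (cases n) (simp_all add: pderiv_power_Suc del: of_nat_Suc power_Suc)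
  thus "pderiv (w ^ (CHAR('a) * m)) = 0" by simp
qed

text \<open>An \<open>n\<close> prime to the characteristic is invertible in R by Bezout, so a
  \<open>d\<close> dividing \<open>n * coeff w n\<close> divides the coefficient itself.\<close>

lemma const_dvd_diff_pth_part:
  fixes w :: "'a::idom poly"
  assumes "CHAR('a) > 0" "[:d:] dvd pderiv w"
  shows "[:d:] dvd w - pth_part CHAR('a) w"
  unfolding const_poly_dvd_iff
proof
  fix n
  have "d dvd coeff w n" if n: "\<not> CHAR('a) dvd n"
  proof -
    from that obtain m where m: "n = Suc m" by (cases n) auto
    have "d dvd coeff (pderiv w) m" using assms(2) const_poly_dvd_iff by blast
    hence *: "d dvd of_nat n * coeff w n" by (simp add: coeff_pderiv m)
    have "coprime n CHAR('a)"
      using n prime_CHAR_semidom[OF assms(1)] by (metis coprime_commute prime_imp_coprime)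
    hence "gcd (int n) (int CHAR('a)) = 1" by (simp add: coprime_iff_gcd_eq_1)
    then obtain u v where uv: "u * int n + v * int CHAR('a) = 1"
      using bezout_int[of "int n" "int CHAR('a)"] by auto
    have "of_int u * of_nat n = (1 :: 'a)"
      using arg_cong[OF uv, of "of_int :: int \<Rightarrow> 'a"] by simp
    hence "coeff w n = of_int u * (of_nat n * coeff w n)"
      by (simp add: mult.assoc[symmetric])
    thus ?thesis using * by (metis dvd_mult)
  qed
  thus "d dvd coeff (w - pth_part CHAR('a) w) n" by simp
qed

text \<open>The projection acts on the coefficients in y, then x is set to y. The result is linear
  over \<open>R[x]\<close>, with x acting as y.\<close>

definition collapse :: "nat \<Rightarrow> 'a::idom poly poly \<Rightarrow> 'a poly" where
  "collapse p P = poly (map_poly (pth_part p) P) [:0, 1:]"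

lemma collapse_0 [simp]: "collapse p 0 = 0"
  by (simp add: collapse_def)

lemma collapse_pCons [simp]:
  "collapse p (pCons c P) = pth_part p c + [:0, 1:] * collapse p P"
  by (simp add: collapse_def map_poly_pCons)

lemma collapse_add: "collapse p (P + Q) = collapse p P + collapse p Q"
  by (induction P Q rule: poly_induct2) (simp_all add: pth_part_add algebra_simps)

lemma collapse_diff: "collapse p (P - Q) = collapse p P - collapse p Q"
  using collapse_add[of p "P - Q" Q] by simp

lemma collapse_X2_power: "collapse p (X2 ^ n * P) = monom 1 n * collapse p P"
  by (induction n) (simp_all add: X2_def monom_0 monom_Suc mult.assoc)

lemma collapse_smult_const: "collapse p (smult [:r:] P) = smult r (collapse p P)"
  by (induction P) (simp_all add: pth_part_smult algebra_simps smult_add_right)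

lemma collapse_smult_monom: "collapse p (smult (monom 1 p) P) = monom 1 p * collapse p P"
  by (induction P) (simp_all add: pth_part_monom_mult distrib_left mult.left_commute)

lemma collapse_mult_eval2: "collapse p (P * eval2 w X2) = collapse p P * w"
proof (induction w arbitrary: P)
  case (pCons c w)
  have "P * eval2 (pCons c w) X2 = smult [:c:] P + (X2 * P) * eval2 w X2"
    by (simp add: cst2_def algebra_simps)
  hence "collapse p (P * eval2 (pCons c w) X2) = smult c (collapse p P) + collapse p (X2 * P) * w"
    by (simp only: collapse_add collapse_smult_const pCons.IH)
  also have "\<dots> = collapse p P * pCons c w"
    by (simp add: X2_def algebra_simps)
  finally show ?case .
qed simp

lemma collapse_pcompose_eval2:
  "collapse p (E \<circ>\<^sub>p eval2 w X2) = poly (map_poly (pth_part p) E) w"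
proof (induction E)
  case (pCons c E)
  have "collapse p (E \<circ>\<^sub>p eval2 w X2 * eval2 w X2) = poly (map_poly (pth_part p) E) w * w"
    by (simp only: collapse_mult_eval2 pCons.IH)
  thus ?case
    by (simp add: pcompose_pCons collapse_add map_poly_pCons mult.commute)
qed simp

lemma X2_diff_Y2_power_CHAR:
  assumes "CHAR('a::idom) > 0"
  shows "(X2 - Y2 :: 'a poly poly) ^ CHAR('a) = X2 ^ CHAR('a) - Y2 ^ CHAR('a)"
proof -
  have "prime CHAR('a poly poly)"
    using prime_CHAR_semidom[OF assms] by simp
  \<comment> \<open>Applied to the sum \<open>(X2 - Y2) + Y2\<close>, which avoids the sign
    \<open>(-1) ^ p\<close>.\<close>
  from freshmans_dream[OF this refl, of "X2 - Y2" Y2] show ?thesis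
    by (simp add: algebra_simps)
qed

text \<open>Under \<open>collapse\<close>, multiplication by \<open>X2 ^ p\<close> and by
  \<open>Y2 ^ p\<close> both become multiplication by \<open>monom 1 p\<close>, and
  \<open>(X2 - Y2) ^ p\<close> is their difference.\<close>

lemma collapse_X2_diff_Y2_power:
  fixes P :: "'a::idom poly poly"
  assumes "CHAR('a) > 0"
  shows "collapse CHAR('a) ((X2 - Y2) ^ CHAR('a) * P) = 0"
proof -
  have "(Y2 :: 'a poly poly) ^ n = [:monom 1 n:]" for n
    by (induction n) (simp_all add: Y2_def one_pCons monom_Suc monom_0 mult.commute)
  hence "(X2 - Y2) ^ CHAR('a) * P = X2 ^ CHAR('a) * P - smult (monom 1 CHAR('a)) P"
    by (simp add: X2_diff_Y2_power_CHAR[OF assms] algebra_simps)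
  thus ?thesis
    by (simp add: collapse_diff collapse_X2_power collapse_smult_monom)
qed

lemma X2_split:
  fixes P :: "'a::idom poly poly"
  shows "\<exists>Q. P = [:poly P [:0, 1:]:] + (X2 - Y2) * Q"
proof -
  have "P = [:poly P [:0, 1:]:] + [:- [:0, 1:], 1:] * synthetic_div P [:0, 1:]"
    using synthetic_div_correct'[of "[:0, 1:]" P] by (simp add: add.commute)
  moreover have "X2 - Y2 = ([:- [:0, 1:], 1:] :: 'a poly poly)"
    by (simp add: X2_def Y2_def)
  ultimately show ?thesis by metis
qed

lemma pcompose_power: "(P ^ n) \<circ>\<^sub>p Q = (P \<circ>\<^sub>p Q) ^ n" for P Q :: "'a::idom poly"
  by (induction n) (simp_all add: pcompose_mult pcompose_1)

text \<open>With \<open>\<tau> = x - y\<close>, the increment \<open>G = g(x) - g(y)\<close> is \<open>\<tau> (g'(y) + \<tau> h)\<close>; after inverting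
  \<open>g'(y)\<close> it generates the same ideal modulo every power of \<open>\<tau>\<close>, so every polynomial can
  be expanded \<open>G\<close>-adically.\<close>

lemma increment_expansion:
  fixes g :: "'a::idom poly"
  defines "G \<equiv> eval2 g X2 - eval2 g Y2"
  shows "\<exists>m E K. [:pderiv g ^ m:] * H = E \<circ>\<^sub>p G + (X2 - Y2) ^ n * K"
proof (induction n)
  case 0
  show ?case by (intro exI[of _ 0] exI[of _ H]) (simp add: one_pCons)
next
  case (Suc n)
  define \<tau> where "\<tau> = (X2 - Y2 :: 'a poly poly)"
  define D where "D = pderiv g"
  obtain m E K where 1: "[:D ^ m:] * H = E \<circ>\<^sub>p G + \<tau> ^ n * K"
    using Suc unfolding \<tau>_def D_def by blast
  \<comment> \<open>Only the value of \<open>K\<close> on the diagonal x = y matters at order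
    \<open>n\<close>; the rest passes to the next order.\<close>
  obtain K1 where K1: "K = [:poly K [:0, 1:]:] + \<tau> * K1"
    using X2_split[of K] unfolding \<tau>_def by blast
  define k where "k = poly K [:0, 1:]"
  obtain h where "eval2 g (Y2 + \<tau>) = eval2 g Y2 + eval2 D Y2 * \<tau> + \<tau>^2 * h"
    using eval2_taylor unfolding D_def by blast
  hence G: "G = \<tau> * ([:D:] + \<tau> * h)"
    by (simp add: G_def \<tau>_def eval2_Y2 algebra_simps power2_eq_square)
  have "([:D:] + \<tau> * h) - [:D:] dvd ([:D:] + \<tau> * h) ^ n - [:D:] ^ n"
    by (metis power_diff_sumr2 dvd_triv_left)
  hence "\<tau> dvd ([:D:] + \<tau> * h) ^ n - [:D:] ^ n" by (simp add: dvd_mult_left)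
  then obtain L where L: "([:D:] + \<tau> * h) ^ n = [:D:] ^ n + \<tau> * L"
    by (metis dvdE add.commute diff_add_cancel)
  have Gn: "G ^ n = \<tau> ^ n * ([:D:] ^ n + \<tau> * L)"
    by (simp add: G power_mult_distrib L)
  \<comment> \<open>The leading term of \<open>G ^ n\<close> is \<open>D ^ n * \<tau> ^ n\<close>,
    so multiplying by \<open>D ^ n\<close> trades \<open>k * \<tau> ^ n\<close> for
    \<open>k * G ^ n\<close> up to order \<open>n + 1\<close>.\<close>
  have "[:D ^ (m + n):] * H = [:D:] ^ n * ([:D ^ m:] * H)"
    by (simp add: poly_const_pow power_add mult.commute)
  also have "\<dots> = [:D:] ^ n * (E \<circ>\<^sub>p G) + [:k:] * ([:D:] ^ n * \<tau> ^ n) + \<tau> ^ Suc n * ([:D:] ^ n * K1)"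
    unfolding 1 by (subst K1) (simp add: k_def algebra_simps)
  also have "[:k:] * ([:D:] ^ n * \<tau> ^ n) = [:k:] * G ^ n - \<tau> ^ Suc n * ([:k:] * L)"
    by (simp add: Gn algebra_simps)
  also have "[:D:] ^ n * (E \<circ>\<^sub>p G) + ([:k:] * G ^ n - \<tau> ^ Suc n * ([:k:] * L)) + \<tau> ^ Suc n * ([:D:] ^ n * K1)
      = ([:D:] ^ n * E + [:k:] * [:0, 1:] ^ n) \<circ>\<^sub>p G + \<tau> ^ Suc n * ([:D:] ^ n * K1 - [:k:] * L)"
    by (simp add: pcompose_add pcompose_mult pcompose_smult pcompose_power pcompose_pCons algebra_simps poly_const_pow)
  finally show ?case unfolding \<tau>_def D_def by blast
qed

text \<open>A denominator-explicit form of \<open>k(y) = k(y\<^sup>p, g)\<close> for \<open>g' \<noteq> 0\<close>. Take the \<open>G\<close>-adic expansion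
  of \<open>x\<close> modulo \<open>(x - y)\<^sup>p = x\<^sup>p - y\<^sup>p\<close> and apply the \<open>R[y\<^sup>p]\<close>-linear projection to its coefficients
  in \<open>y\<close>; that congruence is exactly what makes \<open>collapse\<close> well defined.\<close>

lemma var_in_subring:
  fixes g :: "'a::idom poly"
  assumes "CHAR('a) > 0"
  shows "\<exists>m E. pderiv g ^ (CHAR('a) * m) * [:0, 1:] = poly (map_poly (pth_part CHAR('a)) E) g"
proof -
  define p where "p = CHAR('a)"
  have p: "p > 0" using assms by (simp add: p_def)
  define G where "G = eval2 g X2 - eval2 g Y2"
  obtain m E K where 1: "[:pderiv g ^ m:] * X2 = E \<circ>\<^sub>p G + (X2 - Y2) ^ p * K"
    using increment_expansion[of g X2 p] unfolding G_def by blast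
  \<comment> \<open>\<open>c\<close> raises the exponent \<open>m\<close> to \<open>p * m\<close>:
    the factor of \<open>X2\<close> becomes a \<open>p\<close>-th power, which the projection
    fixes.\<close>
  define c where "c = pderiv g ^ (m * (p - 1))"
  \<comment> \<open>Recentred so that inserting \<open>g(x)\<close> into \<open>E'\<close> gives
    \<open>c\<close> times the value of \<open>E\<close> at \<open>g(x) - g(y)\<close>.\<close>
  define E' where "E' = smult c E \<circ>\<^sub>p [:-g, 1:]"
  have "m * p = m * (p - 1) + m" using p by (cases p) auto
  hence "[:pderiv g ^ (p * m):] * X2 = smult c ([:pderiv g ^ m:] * X2)"
    by (simp add: c_def mult.commute power_add)
  also have "\<dots> = E' \<circ>\<^sub>p eval2 g X2 + (X2 - Y2) ^ p * ([:c:] * K)"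
  proof -
    have "[:-g, 1:] \<circ>\<^sub>p eval2 g X2 = G"
      by (simp add: G_def eval2_Y2 pcompose_pCons)
    thus ?thesis
      unfolding 1 by (simp add: E'_def pcompose_assoc[symmetric] pcompose_smult smult_add_right)
  qed
  finally have "collapse p ([:pderiv g ^ (p * m):] * X2) = poly (map_poly (pth_part p) E') g"
    using collapse_X2_diff_Y2_power[OF assms, of "[:c:] * K"] by (simp add: collapse_add collapse_pcompose_eval2 p_def)
  moreover have "collapse p ([:pderiv g ^ (p * m):] * X2) = pderiv g ^ (p * m) * [:0, 1:]"
    using pth_part_power[of "pderiv g" m] by (simp add: X2_def p_def)
  ultimately show ?thesis unfolding p_def by metis
qed

section \<open>Residues of invariants\<close>

text \<open>For a substitution \<open>\<phi>\<close> the admissible \<open>w\<close> form an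
  R-subalgebra of \<open>R[y]\<close>, so it suffices to find \<open>y^p\<close> and
  \<open>\<eta>\<close> in it.\<close>

definition invariant_mod ::
    "('a::idom poly poly \<Rightarrow> 'a poly poly) \<Rightarrow> 'a poly poly \<Rightarrow> 'a poly \<Rightarrow> bool" where
  "invariant_mod \<phi> b w \<longleftrightarrow> (\<exists>h \<in> fixed_ring \<phi>. b dvd eval2 w Y2 - h)"

lemma invariant_mod_dvd: "invariant_mod \<phi> b w \<Longrightarrow> c dvd b \<Longrightarrow> invariant_mod \<phi> c w"
  unfolding invariant_mod_def using dvd_trans by blast

context
  fixes \<phi> :: "'a::idom poly poly \<Rightarrow> 'a poly poly" and u v
  assumes \<phi>: "\<phi> = subst2 u v"
begin

lemma fixed_ring_subst2:
  "cst2 r \<in> fixed_ring \<phi>"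
  "P \<in> fixed_ring \<phi> \<Longrightarrow> Q \<in> fixed_ring \<phi> \<Longrightarrow> P + Q \<in> fixed_ring \<phi>"
  "P \<in> fixed_ring \<phi> \<Longrightarrow> Q \<in> fixed_ring \<phi> \<Longrightarrow> P - Q \<in> fixed_ring \<phi>"
  "P \<in> fixed_ring \<phi> \<Longrightarrow> Q \<in> fixed_ring \<phi> \<Longrightarrow> P * Q \<in> fixed_ring \<phi>"
  by (auto simp: fixed_ring_def \<phi>)

text \<open>\<open>P\<close> cancels from \<open>P * \<phi> Q = P * Q\<close>. This permits division
  of invariants by \<open>d\<close> and \<open>D\<close>.\<close>

lemma fixed_ring_subst2_cancel:
  "P * Q \<in> fixed_ring \<phi> \<Longrightarrow> P \<in> fixed_ring \<phi> \<Longrightarrow> P \<noteq> 0 \<Longrightarrow> Q \<in> fixed_ring \<phi>"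
  by (auto simp: fixed_ring_def \<phi>)

lemma invariant_mod_const: "invariant_mod \<phi> b [:r:]"
  unfolding invariant_mod_def using fixed_ring_subst2(1)[of r]
  by (intro bexI[of _ "cst2 r"]) auto

lemma invariant_mod_add:
  assumes "invariant_mod \<phi> b w" "invariant_mod \<phi> b w'"
  shows "invariant_mod \<phi> b (w + w')"
proof -
  obtain h h' where h: "h \<in> fixed_ring \<phi>" "b dvd eval2 w Y2 - h"
    and h': "h' \<in> fixed_ring \<phi>" "b dvd eval2 w' Y2 - h'"
    using assms unfolding invariant_mod_def by blast
  have "eval2 (w + w') Y2 - (h + h') = (eval2 w Y2 - h) + (eval2 w' Y2 - h')" by simp
  thus ?thesis unfolding invariant_mod_def
    using h h' fixed_ring_subst2(2) by (metis dvd_add)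
qed

lemma invariant_mod_mult:
  assumes "invariant_mod \<phi> b w" "invariant_mod \<phi> b w'"
  shows "invariant_mod \<phi> b (w * w')"
proof -
  obtain h h' where h: "h \<in> fixed_ring \<phi>" "b dvd eval2 w Y2 - h"
    and h': "h' \<in> fixed_ring \<phi>" "b dvd eval2 w' Y2 - h'"
    using assms unfolding invariant_mod_def by blast
  have "eval2 (w * w') Y2 - h * h' = (eval2 w Y2 - h) * eval2 w' Y2 + h * (eval2 w' Y2 - h')"
    by (simp add: algebra_simps)
  thus ?thesis unfolding invariant_mod_def
    using h h' fixed_ring_subst2(4) by (metis dvd_add dvd_mult dvd_mult2)
qed

lemma invariant_mod_power: "invariant_mod \<phi> b w \<Longrightarrow> invariant_mod \<phi> b (w ^ n)"
  using invariant_mod_const[of b 1]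
  by (induction n) (auto simp: one_pCons invariant_mod_mult)

lemma invariant_mod_pth_part:
  assumes "invariant_mod \<phi> b (monom 1 p)"
  shows "invariant_mod \<phi> b (pth_part p w)"
proof -
  have term_inv: "invariant_mod \<phi> b (monom r i)" if "p dvd i" for r i
  proof -
    from that obtain k where "i = p * k" by blast
    hence "monom r i = [:r:] * monom 1 p ^ k"
      by (simp add: monom_power smult_monom)
    thus ?thesis using assms invariant_mod_const invariant_mod_mult invariant_mod_power by metis
  qed
  have "invariant_mod \<phi> b 0" using invariant_mod_const[of b 0] by simp
  hence "invariant_mod \<phi> b (\<Sum>i\<in>S. if p dvd i then monom (coeff w i) i else 0)" for S
    by (induction S rule: infinite_finite_induct) (auto intro!: invariant_mod_add term_inv)
  thus ?thesis unfolding pth_part_def .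
qed

lemma invariant_mod_poly_pth_part:
  assumes "invariant_mod \<phi> b (monom 1 p)" "invariant_mod \<phi> b g"
  shows "invariant_mod \<phi> b (poly (map_poly (pth_part p) E) g)"
proof (induction E)
  case 0
  show ?case using invariant_mod_const[of b 0] by simp
next
  case (pCons c E)
  thus ?case
    by (simp add: map_poly_pCons invariant_mod_add invariant_mod_mult invariant_mod_pth_part assms)
qed

end

text \<open>Degrees add over a domain, first in x and then in y, so both must vanish for a divisor
  of a nonzero constant.\<close>

lemma dvd_cst2_imp_cst2:
  fixes r :: "'a::idom"
  assumes "w dvd cst2 r" "r \<noteq> 0"
  shows "\<exists>s. w = cst2 s"
proof -
  obtain k where k: "w * k = cst2 r" using assms(1) by (metis dvdE)
  hence nz: "w \<noteq> 0" "k \<noteq> 0" using assms(2) by (auto simp: cst2_def)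
  have "degree (w * k) = 0" by (simp add: k cst2_def)
  hence "degree w = 0" "degree k = 0" using nz by (simp_all add: degree_mult_eq)
  then obtain w0 k0 where wk: "w = [:w0:]" "k = [:k0:]" by (metis degree_eq_zeroE)
  hence "w0 * k0 = [:r:]" using k by (simp add: cst2_def mult.commute)
  moreover from wk nz have "w0 \<noteq> 0" "k0 \<noteq> 0" by auto
  ultimately have "degree w0 = 0"
    by (metis add_is_0 degree_mult_eq degree_pCons_0)
  thus ?thesis using wk by (metis cst2_def degree_eq_zeroE)
qed

section \<open>The equivalences for the ideal and the plinth ideal\<close>

theorem theorem6p7:
  fixes a d :: "'a::{factorial_semiring, idom}"
    and \<theta> :: "'a poly"
    and F q :: "'a poly poly"
  assumes char_pos: "CHAR('a) > 0"
    and a_nz: "a \<noteq> 0"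
    and theta_nz: "\<theta> \<noteq> 0"
    and theta_in_yRy: "coeff \<theta> 0 = 0"
    and F_nz: "F \<noteq> 0"
    and F_in_Rf: "\<exists>G :: 'a poly. F = eval2 G (cst2 a * X2 + eval2 \<theta> Y2)"
    and q_def: "cst2 a * q = eval2 \<theta> Y2 - eval2 \<theta> (Y2 + cst2 a * F)"
    and d_gcd: "[:d:] dvd [:a:]" "[:d:] dvd pderiv \<theta>"
               "\<forall>e. e dvd [:a:] \<and> e dvd pderiv \<theta> \<longrightarrow> e dvd [:d:]"
  defines "\<phi> \<equiv> subst2 (X2 + q) (Y2 + cst2 a * F)"
    and "I \<equiv> {cst2 a * u + eval2 (pderiv \<theta>) Y2 * v | u v. True}"
  shows "((\<exists>g. I = principal_in UNIV g) \<longleftrightarrow> I = principal_in UNIV (cst2 d))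
       \<and> (I = principal_in UNIV (cst2 d) \<longleftrightarrow> plinth \<phi> = principal_in (fixed_ring \<phi>) (cst2 d * F))
       \<and> (plinth \<phi> = principal_in (fixed_ring \<phi>) (cst2 d * F)
            \<longleftrightarrow> (\<exists>g \<in> fixed_ring \<phi>. plinth \<phi> = principal_in (fixed_ring \<phi>) g))"
proof -
  define p where "p = CHAR('a)"
  define A where "A = cst2 a * F"
  define f where "f = cst2 a * X2 + eval2 \<theta> Y2"
  define D where "D = cst2 d * F"
  have p: "p > 1" using prime_CHAR_semidom[OF char_pos] prime_gt_1_nat by (simp add: p_def)
  have \<phi>: "\<phi> = subst2 (X2 + q) (Y2 + A)" by (simp add: \<phi>_def A_def)
  have cst2_eq_0: "cst2 r = 0 \<longleftrightarrow> r = 0" for r :: 'a by (simp add: cst2_def)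
  have cst2_nz: "cst2 a \<noteq> 0" using a_nz by (simp add: cst2_eq_0)
  note fixed_simps = fixed_ring_subst2[OF \<phi>]

  obtain a' where a': "a = d * a'" using d_gcd(1) by auto
  have d_nz: "d \<noteq> 0" and a'_nz: "a' \<noteq> 0" using a' a_nz by auto
  \<comment> \<open>\<open>th\<close> is the \<open>\<eta>\<close> of the overview.\<close>
  obtain th where th: "\<theta> - pth_part p \<theta> = [:d:] * th"
    using const_dvd_diff_pth_part[OF char_pos d_gcd(2)] unfolding p_def by blast
  have "pderiv \<theta> = pderiv (\<theta> - pth_part p \<theta>)"
    by (simp add: pderiv_diff p_def pderiv_pth_part)
  hence th': "pderiv \<theta> = [:d:] * pderiv th"
    by (simp add: th pderiv_smult)
  have a_split: "cst2 a = cst2 d * cst2 a'" by (simp add: a')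
  have theta'_split: "eval2 (pderiv \<theta>) Y2 = cst2 d * eval2 (pderiv th) Y2"
    by (simp add: th')

  have f_fixed: "f \<in> fixed_ring \<phi>"
    using q_def by (simp add: fixed_ring_def f_def \<phi> subst2_eval2 A_def algebra_simps)
  have F_fixed: "F \<in> fixed_ring \<phi>"
    using F_in_Rf f_fixed by (auto simp: fixed_ring_def \<phi> subst2_eval2 f_def)
  have A_fixed: "A \<in> fixed_ring \<phi>" and D_fixed: "D \<in> fixed_ring \<phi>"
    using F_fixed fixed_simps by (auto simp: A_def D_def)
  have AD: "A = cst2 a' * D" by (simp add: A_def D_def a_split)
  have D_nz: "D \<noteq> 0" using d_nz F_nz by (simp add: D_def cst2_eq_0)
  have one_fixed: "1 \<in> fixed_ring \<phi>" using fixed_simps(1)[of 1] by simp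

  \<comment> \<open>The ideal \<open>I\<close>, increments and the plinth ideal\<close>
  have I_mem: "cst2 a * u + eval2 (pderiv \<theta>) Y2 * v \<in> I" for u v
    unfolding I_def by blast
  have I_sub: "i \<in> I \<Longrightarrow> cst2 d dvd i" for i
    unfolding I_def a_split theta'_split by (auto simp: mult.assoc)
  \<comment> \<open>Both generators of \<open>I\<close> are multiples of \<open>d\<close>, so only
    the membership of \<open>d\<close> is at stake.\<close>
  have I_eqI: "I = principal_in UNIV (cst2 d)" if d_mem: "cst2 d \<in> I"
  proof (intro set_eqI iffI)
    fix i assume "i \<in> I"
    thus "i \<in> principal_in UNIV (cst2 d)"
      using I_sub by (auto simp: principal_in_def elim!: dvdE)
  next
    fix i assume "i \<in> principal_in UNIV (cst2 d)"
    then obtain k where "i = cst2 d * k" by (auto simp: principal_in_def)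
    moreover obtain u v where "cst2 d = cst2 a * u + eval2 (pderiv \<theta>) Y2 * v"
      using d_mem unfolding I_def by auto
    ultimately have "i = cst2 a * (u * k) + eval2 (pderiv \<theta>) Y2 * (v * k)"
      by (simp add: algebra_simps)
    thus "i \<in> I" using I_mem by metis
  qed

  have \<delta>_in_FI: "\<exists>i\<in>I. \<phi> u - u = F * i" for u
  proof -
    obtain r s where rs: "\<phi> u - u = q * r + A * s"
      using subst2_shift unfolding \<phi> by blast
    obtain h where "eval2 \<theta> (Y2 + A) = eval2 \<theta> Y2 + eval2 (pderiv \<theta>) Y2 * A + A^2 * h"
      using eval2_taylor by blast
    \<comment> \<open>Cancelling \<open>a\<close> shows that \<open>q\<close>, like
      \<open>A\<close>, lies in \<open>F I\<close>.\<close>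
    hence "cst2 a * q = cst2 a * - (F * (eval2 (pderiv \<theta>) Y2 + cst2 a * F * h))"
      using q_def by (simp add: A_def algebra_simps power2_eq_square)
    hence q_eq: "q = - (F * (eval2 (pderiv \<theta>) Y2 + cst2 a * F * h))"
      using cst2_nz by (metis mult_left_cancel)
    have "\<phi> u - u = F * (cst2 a * (s - F * h * r) + eval2 (pderiv \<theta>) Y2 * (- r))"
      unfolding rs A_def by (subst q_eq) (simp add: algebra_simps)
    thus ?thesis using I_mem by metis
  qed
  have plinth_dvd: "\<exists>w \<in> fixed_ring \<phi>. c = D * w" if "c \<in> plinth \<phi>" for c
  proof -
    from that obtain u where u: "c = \<phi> u - u" "c \<in> fixed_ring \<phi>"
      by (auto simp: plinth_def)
    obtain i where "i \<in> I" "c = F * i" using \<delta>_in_FI u by metis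
    moreover then obtain w where "i = cst2 d * w" using I_sub by (metis dvdE)
    ultimately have "c = D * w" by (simp add: D_def)
    thus ?thesis using u(2) D_fixed D_nz fixed_ring_subst2_cancel[OF \<phi>] by metis
  qed
  have plinth_mem: "c \<in> plinth \<phi>" if "\<phi> u - u = c" "c \<in> fixed_ring \<phi>" for c u
    using that unfolding plinth_def by blast
  have plinthI: "D * c \<in> plinth \<phi>"
    if c: "c \<in> fixed_ring \<phi>" and h: "h \<in> fixed_ring \<phi>" and dvd: "cst2 a' dvd c * Y2 - h" for c h
  proof -
    obtain s where s: "c * Y2 - h = cst2 a' * s" using dvd by blast
    have "cst2 a' * (\<phi> s - s) = \<phi> (c * Y2 - h) - (c * Y2 - h)"
      unfolding s by (simp add: \<phi> algebra_simps)
    also have "\<dots> = c * A" using c h by (simp add: fixed_ring_def \<phi> algebra_simps)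
    also have "\<dots> = cst2 a' * (D * c)" by (simp add: AD mult_ac)
    finally have "\<phi> s - s = D * c" using a'_nz by (simp add: cst2_eq_0)
    thus ?thesis using c D_fixed fixed_simps(4) plinth_mem by blast
  qed

  \<comment> \<open>Residues of invariants modulo \<open>a\<close> and \<open>a'\<close>\<close>
  have monom_inv_a: "invariant_mod \<phi> (cst2 a) (monom 1 p)"
  proof -
    have "prime CHAR('a poly poly)" using prime_CHAR_semidom[OF char_pos] by simp
    from freshmans_dream[OF this, of p Y2 A] have "(Y2 + A) ^ p = Y2 ^ p + A ^ p"
      by (simp add: p_def)
    moreover have "A ^ p = A ^ (p - 1) * A" using p by (cases p) (auto simp: mult.commute)
    ultimately have "Y2 ^ p - A ^ (p - 1) * Y2 \<in> fixed_ring \<phi>"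
      using A_fixed by (simp add: fixed_ring_def \<phi> algebra_simps)
    moreover have "eval2 (monom (1 :: 'a) p) Y2 = Y2 ^ p"
      by (simp add: monom_altdef)
    \<comment> \<open>As \<open>p > 1\<close>, the exponent is positive, so the correction term
      vanishes modulo \<open>a\<close>.\<close>
    moreover have "cst2 a dvd A ^ (p - 1)"
      using p by (intro dvd_trans[OF _ dvd_power]) (simp_all add: A_def)
    ultimately show ?thesis unfolding invariant_mod_def
      by (intro bexI[of _ "Y2 ^ p - A ^ (p - 1) * Y2"]) simp_all
  qed
  have "cst2 a' dvd cst2 a" by (simp add: a_split)
  hence monom_inv: "invariant_mod \<phi> (cst2 a') (monom 1 p)"
    using monom_inv_a invariant_mod_dvd by blast
  have th_inv: "invariant_mod \<phi> (cst2 a') th"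
  proof -
    obtain l where l: "l \<in> fixed_ring \<phi>" "cst2 a dvd eval2 (pth_part p \<theta>) Y2 - l"
      using invariant_mod_pth_part[OF \<phi> monom_inv_a] unfolding invariant_mod_def by blast
    then obtain k where k: "eval2 (pth_part p \<theta>) Y2 - l = cst2 a * k" by blast
    have "eval2 (\<theta> - pth_part p \<theta>) Y2 = cst2 d * eval2 th Y2"
      unfolding th by simp
    hence "eval2 \<theta> Y2 = eval2 (pth_part p \<theta>) Y2 + cst2 d * eval2 th Y2"
      by (simp add: algebra_simps)
    \<comment> \<open>Dividing by \<open>d\<close> turns a congruence modulo \<open>a\<close> into
      one modulo \<open>a'\<close>; hence \<open>monom_inv_a\<close> was proved for \<open>a\<close>
      first.\<close>
    hence "f - l = cst2 d * (eval2 th Y2 + cst2 a' * (X2 + k))"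
      using k by (simp add: f_def a_split algebra_simps)
    moreover have "f - l \<in> fixed_ring \<phi>" using f_fixed l(1) fixed_simps(3) by blast
    ultimately have "eval2 th Y2 + cst2 a' * (X2 + k) \<in> fixed_ring \<phi>"
      using fixed_ring_subst2_cancel[OF \<phi>] fixed_simps(1) d_nz by (metis cst2_eq_0)
    thus ?thesis unfolding invariant_mod_def
      by (intro bexI[of _ "eval2 th Y2 + cst2 a' * (X2 + k)"]) simp_all
  qed
  obtain m E where mE: "pderiv th ^ (p * m) * [:0, 1:] = poly (map_poly (pth_part p) E) th"
    using var_in_subring[OF char_pos, of th] unfolding p_def by blast
  define C where "C = pderiv th ^ (p * m)"
  \<comment> \<open>Such a power has derivative zero, so it is a polynomial in \<open>y^p\<close>.
    Arbitrary \<open>w\<close> is allowed because the inverse of \<open>\<eta>'\<close> needs it as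
    well.\<close>
  have power_inv: "invariant_mod \<phi> (cst2 a') (w ^ (p * m))" for w
    using invariant_mod_pth_part[OF \<phi> monom_inv] pth_part_power[of w m] unfolding p_def by metis
  have Cy_inv: "invariant_mod \<phi> (cst2 a') (C * [:0, 1:])"
    unfolding C_def mE by (rule invariant_mod_poly_pth_part[OF \<phi> monom_inv th_inv])

  \<comment> \<open>The implications between the four conditions\<close>
  have a_imp_b: "I = principal_in UNIV (cst2 d)" if I: "I = principal_in UNIV g" for g
  proof (rule I_eqI)
    have "cst2 a \<in> I" "eval2 (pderiv \<theta>) Y2 \<in> I"
      using I_mem[of 1 0] I_mem[of 0 1] by auto
    hence dvd: "g dvd cst2 a" "g dvd eval2 (pderiv \<theta>) Y2"
      unfolding I by (auto simp: principal_in_def)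
    \<comment> \<open>A generator dividing the nonzero constant \<open>a\<close> is constant, so its
      divisibility relations descend to \<open>R[y]\<close>, where the gcd property applies.\<close>
    then obtain s where s: "g = cst2 s" using dvd_cst2_imp_cst2 a_nz by blast
    hence "[:s:] dvd [:a:]" "[:s:] dvd pderiv \<theta>"
      using dvd by (simp_all add: cst2_def eval2_Y2)
    hence "[:s:] dvd [:d:]" using d_gcd(3) by blast
    hence "g dvd cst2 d" by (simp add: s cst2_def)
    thus "cst2 d \<in> I" unfolding I by (auto simp: principal_in_def elim!: dvdE)
  qed

  have b_imp_c: "plinth \<phi> = principal_in (fixed_ring \<phi>) D" if I: "I = principal_in UNIV (cst2 d)"
  proof -
    have "cst2 d \<in> I" unfolding I by (auto simp: principal_in_def intro: exI[of _ 1])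
    then obtain u v where "cst2 d = cst2 a * u + eval2 (pderiv \<theta>) Y2 * v"
      unfolding I_def by auto
    hence "cst2 d * 1 = cst2 d * (cst2 a' * u + eval2 (pderiv th) Y2 * v)"
      by (simp add: a_split theta'_split algebra_simps)
    hence "1 = cst2 a' * u + [:pderiv th:] * v"
      using d_nz unfolding eval2_Y2 by (metis cst2_eq_0 mult_left_cancel)
    \<comment> \<open>Setting x = 0 turns this into an identity in \<open>R[y]\<close>.\<close>
    from arg_cong[OF this, of "\<lambda>P. coeff P 0"]
    have "1 = [:a':] * coeff u 0 + pderiv th * coeff v 0"
      by (simp add: cst2_def)
    hence "[:a':] dvd 1 - pderiv th * coeff v 0"
      by (metis add_diff_cancel_right' dvd_triv_left)
    \<comment> \<open>The power \<open>p * m\<close> of the inverse of \<open>\<eta>'\<close>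
      inverts \<open>C\<close> and is itself a residue of an invariant; so y, its product with
      \<open>C y\<close> modulo \<open>a'\<close>, is one too.\<close>
    moreover have "1 - pderiv th * coeff v 0 dvd 1 - (pderiv th * coeff v 0) ^ (p * m)"
      by (metis power_diff_sumr2 power_one dvd_triv_left)
    ultimately have "[:a':] dvd 1 - C * coeff v 0 ^ (p * m)"
      unfolding C_def power_mult_distrib by (rule dvd_trans)
    hence "[:a':] dvd (1 - C * coeff v 0 ^ (p * m)) * [:0, 1:]" by (rule dvd_mult2)
    then obtain w where w0: "[:0, 1:] - C * coeff v 0 ^ (p * m) * [:0, 1:] = [:a':] * w"
      by (metis dvdE left_diff_distrib mult_1)
    have w: "Y2 - eval2 (coeff v 0 ^ (p * m) * (C * [:0, 1:])) Y2 = cst2 a' * eval2 w Y2"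
      using arg_cong[OF w0, of "\<lambda>P. eval2 P Y2"] by (simp add: algebra_simps)
    obtain h where h: "h \<in> fixed_ring \<phi>"
        "cst2 a' dvd eval2 (coeff v 0 ^ (p * m) * (C * [:0, 1:])) Y2 - h"
      using invariant_mod_mult[OF \<phi> power_inv Cy_inv] unfolding invariant_mod_def by blast
    have "Y2 - h = cst2 a' * eval2 w Y2
        + (eval2 (coeff v 0 ^ (p * m) * (C * [:0, 1:])) Y2 - h)"
      unfolding w[symmetric] by simp
    hence y: "cst2 a' dvd Y2 - h" using h(2) by (metis dvd_add dvd_triv_left)
    have "D * c \<in> plinth \<phi>" if c: "c \<in> fixed_ring \<phi>" for c
    proof (rule plinthI[OF c])
      show "c * h \<in> fixed_ring \<phi>" using c h(1) fixed_simps(4) by blast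
      show "cst2 a' dvd c * Y2 - c * h" using y by (metis dvd_mult right_diff_distrib)
    qed
    thus ?thesis using plinth_dvd by (fastforce simp: principal_in_def)
  qed

  have c_imp_b: "I = principal_in UNIV (cst2 d)" if pl: "plinth \<phi> = principal_in (fixed_ring \<phi>) D"
  proof (rule I_eqI)
    have "D \<in> plinth \<phi>"
      unfolding pl principal_in_def using one_fixed by (auto intro: exI[of _ 1])
    then obtain u where "D = \<phi> u - u" by (auto simp: plinth_def)
    then obtain i where "i \<in> I" "F * cst2 d = F * i"
      using \<delta>_in_FI[of u] by (auto simp: D_def mult.commute)
    thus "cst2 d \<in> I" using F_nz by simp
  qed

  have d_imp_c: "plinth \<phi> = principal_in (fixed_ring \<phi>) D"
    if g: "g \<in> fixed_ring \<phi>" and pl: "plinth \<phi> = principal_in (fixed_ring \<phi>) g" for g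
  proof -
    have "g \<in> plinth \<phi>"
      unfolding pl principal_in_def using one_fixed by (auto intro: exI[of _ 1])
    then obtain w where w: "g = D * w" using plinth_dvd by blast
    have w_dvd: "w dvd c" if mem: "D * c \<in> plinth \<phi>" for c
    proof -
      obtain k where "c = w * k"
        using mem D_nz unfolding pl w by (auto simp: principal_in_def mult.assoc)
      thus ?thesis by simp
    qed
    \<comment> \<open>The increment of y is itself invariant, which forces \<open>w\<close> to
      divide \<open>a'\<close>.\<close>
    have "\<phi> Y2 - Y2 = D * cst2 a'" by (simp add: \<phi> AD mult.commute)
    hence "D * cst2 a' \<in> plinth \<phi>"
      by (rule plinth_mem) (intro fixed_simps D_fixed)
    hence w_a': "w dvd cst2 a'" by (rule w_dvd)
    then obtain r where r: "w = cst2 r" using dvd_cst2_imp_cst2 a'_nz by blast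
    obtain c where c: "c \<in> fixed_ring \<phi>" "cst2 a' dvd eval2 C Y2 - c"
      using power_inv[of "pderiv th"] unfolding invariant_mod_def C_def[symmetric] by blast
    obtain h where h: "h \<in> fixed_ring \<phi>" "cst2 a' dvd eval2 (C * [:0, 1:]) Y2 - h"
      using Cy_inv unfolding invariant_mod_def by blast
    \<comment> \<open>Replacing \<open>C\<close> by its invariant representative \<open>c\<close>
      makes \<open>plinthI\<close> applicable. Since \<open>w\<close> divides \<open>a'\<close>,
      divisibility then returns from \<open>c\<close> to \<open>C\<close>.\<close>
    have "c * Y2 - h = (eval2 (C * [:0, 1:]) Y2 - h) - (eval2 C Y2 - c) * Y2"
      by (simp add: algebra_simps)
    hence "cst2 a' dvd c * Y2 - h" using c(2) h(2) by (simp only: dvd_diff dvd_mult2)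
    hence "w dvd c" using plinthI[OF c(1) h(1)] w_dvd by blast
    moreover have "w dvd eval2 C Y2 - c" using w_a' c(2) dvd_trans by blast
    ultimately have "w dvd eval2 C Y2" by (metis diff_add_cancel dvd_add)
    hence r_C: "[:r:] dvd C" by (simp add: r cst2_def eval2_Y2)
    have r_a': "r dvd a'" using w_a' by (simp add: r cst2_def)
    have "r dvd 1"
    proof (rule ccontr)
      assume "\<not> r dvd 1"
      moreover have "r \<noteq> 0" using r_a' a'_nz by auto
      ultimately obtain \<pi> where \<pi>: "\<pi> dvd r" "prime_elem \<pi>"
        using prime_divisor_exists by (metis prime_imp_prime_elem)
      have "[:\<pi>:] dvd pderiv th ^ (p * m)"
        using \<pi>(1) r_C unfolding C_def by (metis const_poly_dvd_const_poly_iff dvd_trans)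
      \<comment> \<open>A prime of R stays prime in \<open>R[y]\<close>. Then
        \<open>d * \<pi>\<close> would be a common divisor of \<open>a\<close> and
        \<open>\<theta>'\<close>, contradicting the choice of \<open>d\<close>.\<close>
      hence "[:\<pi>:] dvd pderiv th"
        using lift_prime_elem_poly[OF \<pi>(2)] prime_elem_dvd_power by blast
      hence "[:d:] * [:\<pi>:] dvd pderiv \<theta>" unfolding th' by (intro mult_dvd_mono dvd_refl)
      moreover have "[:d:] * [:\<pi>:] dvd [:a:]"
        using \<pi>(1) r_a' by (simp add: a' mult_dvd_mono dvd_trans)
      ultimately have "[:d:] * [:\<pi>:] dvd [:d:]" using d_gcd(3) by blast
      hence "is_unit \<pi>" using d_nz by (simp add: dvd_mult_cancel_left)
      thus False using \<pi>(2) by simp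
    qed
    then obtain r' where r': "r * r' = 1" by (metis dvdE)
    hence D: "D = g * cst2 r'"
      by (simp add: w r mult.assoc cst2_simps(4)[symmetric] del: cst2_simps(4))
    show ?thesis unfolding pl
    proof (intro set_eqI iffI)
      fix z assume "z \<in> principal_in (fixed_ring \<phi>) g"
      then obtain k where k: "z = g * k" "k \<in> fixed_ring \<phi>" by (auto simp: principal_in_def)
      have "z = D * (cst2 r * k)" by (simp add: k(1) w r mult.assoc)
      thus "z \<in> principal_in (fixed_ring \<phi>) D"
        using k(2) fixed_simps(1,4) by (auto simp: principal_in_def)
    next
      fix z assume "z \<in> principal_in (fixed_ring \<phi>) D"
      then obtain k where k: "z = D * k" "k \<in> fixed_ring \<phi>" by (auto simp: principal_in_def)
      have "z = g * (cst2 r' * k)" by (simp add: k(1) D mult.assoc)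
      thus "z \<in> principal_in (fixed_ring \<phi>) g"
        using k(2) fixed_simps(1,4) by (auto simp: principal_in_def)
    qed
  qed

  show ?thesis
    using a_imp_b b_imp_c c_imp_b d_imp_c D_fixed unfolding D_def by blast
qed

end
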